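(* Let $P$ be a finite set of quadratic templates on $\mathbb{R}^d$, i.e. each $p\in P$ has the form $p(x)=x^TA_px+b_p^Tx$ with $A_p$ a real symmetric $d\times d$ matrix and $b_p\in\mathbb{R}^d$. Let $T:\mathbb{R}^d\to\mathbb{R}^d$ be an affine map and let $r:\mathbb{R}^d\to\mathbb{R}$ be a quadratic function. For $w\in\mathcal{F}(P,\overline{\mathbb{R}})$ and $p\in P$ define the abstract values $$\mathrm{Asg}^\sharp(w)(p)=\sup\{p(T(x))\mid x\in\mathbb{R}^d,\ q(x)\le w(q)\ \forall q\in P\},\qquad \mathrm{Tst}^\sharp(w)(p)=\sup\{p(T(x))\mid q(x)\le w(q)\ \forall q\in P,\ r(x)\le 0\}$$ (with $\sup\emptyset=-\infty$), and the relaxed values $$\mathrm{Asg}^{R}(w)(p)=\inf_{\lambda\in\mathcal{F}(P,\mathbb{R}_+)}\ \sup_{x\in\mathbb{R}^d}\Big[p(T(x))+\sum_{q\in P}\lambda(q)\big(w(q)-q(x)\big)\Big],$$ $$\mathrm{Tst}^{R}(w)(p)=\inf_{\lambda\in\mathcal{F}(P,\mathbb{R}_+),\ \mu\in\mathbb{R}_+}\ \sup_{x\in\mathbb{R}^d}\Big[p(T(x))+\sum_{q\in P}\lambda(q)\big(w(q)-q(x)\big)-\mu r(x)\Big].$$ Then: (i) for every $w:P\to\mathbb{R}$ (real-valued) and every $p\in P$, $$\mathrm{Asg}^{R}(w)(p)=\inf\Big\{\eta\ \Big|\ \eta\in\mathbb{R},\ \lambda\in\mathcal{F}(P,\mathbb{R}_+),\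 M(p\circ T)+\eta N(-1)+\sum_{q\in P}\lambda(q)\big(N(w(q))-M(q)\big)\preceq 0\Big\},$$ $$\mathrm{Tst}^{R}(w)(p)=\inf\Big\{\eta\ \Big|\ \eta\in\mathbb{R},\ \lambda\in\mathcal{F}(P,\mathbb{R}_+),\ \mu\in\mathbb{R}_+,\ M(p\circ T)+\eta N(-1)+\sum_{q\in P}\lambda(q)\big(N(w(q))-M(q)\big)-\mu M(r)\preceq 0\Big\}$$ (semi-definite programs, with $\inf\emptyset=+\infty$); and (ii) for every $w\in\mathcal{F}(P,\overline{\mathbb{R}})$, $\mathrm{Asg}^\sharp(w)\le \mathrm{Asg}^{R}(w)$ and $\mathrm{Tst}^\sharp(w)\le\mathrm{Tst}^{R}(w)$ pointwise on $P$.
   Context: $\overline{\mathbb{R}}=\mathbb{R}\cup\{\pm\infty\}$. $\mathcal{F}(P,\overline{\mathbb{R}})$ denotes the set of functions $P\to\overline{\mathbb{R}}$, ordered pointwise; $\mathcal{F}(P,\mathbb{R}_+)$ the set of functions $P\to[0,\infty)$. Extended arithmetic uses the convention $0\cdot(\pm\infty)=0$ and $a\cdot(\pm\infty)=\pm\infty$ for $a>0$. A quadratic function $g$ is written $g(x)=x^TA_gx+b_g^Tx+c_g$ with $A_g$ symmetric; $M(g)$ is the $(d+1)\times(d+1)$ symmetric matrix $\begin{pmatrix} c_g & \tfrac12 b_g^T\\ \tfrac12 b_g & A_g\end{pmatrix}$, and for $y\in\mathbb{R}$, $N(y)$ is the $(d+1)\times(d+1)$ matrix whose $(1,1)$ entry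 is $y$ and all other entries are $0$. $\preceq$ is the Löwner order: $A\preceq B$ iff $B-A$ is positive semi-definite. *)

theory Defs
  imports "HOL-Analysis.Analysis"
begin

definition symmetric_mat :: "real ^ 'n ^ 'n \<Rightarrow> bool" where
  "symmetric_mat A \<longleftrightarrow> transpose A = A"

definition quad :: "real ^ 'd ^ 'd \<Rightarrow> real ^ 'd \<Rightarrow> real \<Rightarrow> real ^ 'd \<Rightarrow> real" where
  "quad A b c x = x \<bullet> (A *v x) + b \<bullet> x + c"

definition quadratic :: "(real ^ 'd \<Rightarrow> real) \<Rightarrow> bool" where
  "quadratic g \<longleftrightarrow> (\<exists>A b c. symmetric_mat A \<and> g = quad A b c)"

definition quadratic_template :: "(real ^ 'd \<Rightarrow> real) \<Rightarrow> bool" where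
  "quadratic_template p \<longleftrightarrow> (\<exists>A b. symmetric_mat A \<and> p = (\<lambda>x. x \<bullet> (A *v x) + b \<bullet> x))"

definition affine_map :: "(real ^ 'd \<Rightarrow> real ^ 'd) \<Rightarrow> bool" where
  "affine_map T \<longleftrightarrow> (\<exists>L v. linear L \<and> T = (\<lambda>x. L x + v))"

text \<open>Matrices of size $d+1$ are indexed by \<^typ>\<open>'d option\<close>; the first index is \<^const>\<open>None\<close>.\<close>

definition block_mat :: "real \<Rightarrow> real ^ 'd \<Rightarrow> real ^ 'd ^ 'd \<Rightarrow> real ^ ('d option) ^ ('d option)" where
  "block_mat c b A = (\<chi> i j.
     case i of
       None \<Rightarrow> (case j of None \<Rightarrow> c | Some l \<Rightarrow> (1/2) * b $ l)
     | Some k \<Rightarrow> (case j of None \<Rightarrow> (1/2) * b $ k | Some l \<Rightarrow> A $ k $ l))"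

text \<open>The matrix of a quadratic function, which is a plain function here: the coefficients with
  symmetric quadratic part are determined by the function, see \<open>quad_inject\<close> and
  \<open>M_quad\<close> below. The value on non-quadratic functions is irrelevant.\<close>

definition M :: "(real ^ 'd \<Rightarrow> real) \<Rightarrow> real ^ ('d option) ^ ('d option)" where
  "M g = (THE m. \<exists>A b c. symmetric_mat A \<and> g = quad A b c \<and> m = block_mat c b A)"

definition N :: "real \<Rightarrow> real ^ ('d::finite option) ^ ('d option)" where
  "N y = (\<chi> i j. if i = None \<and> j = None then y else 0)"

definition pos_semidef :: "real ^ 'n ^ 'n \<Rightarrow> bool" where
  "pos_semidef A \<longleftrightarrow> symmetric_mat A \<and> (\<forall>x. 0 \<le> x \<bullet> (A *v x))"

definition loewner_le :: "real ^ 'n ^ 'n \<Rightarrow> real ^ 'n ^ 'n \<Rightarrow> bool" (infix "\<preceq>" 50) where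
  "A \<preceq> B \<longleftrightarrow> pos_semidef (B - A)"

lemma quad_inject:
  fixes A A' :: "real ^ 'd ^ 'd"
  assumes "symmetric_mat A" "symmetric_mat A'" and eq: "quad A b c = quad A' b' c'"
  shows "A = A'" "b = b'" "c = c'"
proof -
  have q: "x \<bullet> (A *v x) + b \<bullet> x + c = x \<bullet> (A' *v x) + b' \<bullet> x + c'" for x
    using fun_cong[OF eq, of x] by (simp add: quad_def)
  show c: "c = c'" using q[of 0] by simp
  have neg: "(- x) \<bullet> (B *v (- x)) = x \<bullet> (B *v x)" for x :: "real ^ 'd" and B :: "real ^ 'd ^ 'd"
    using matrix_vector_mult_scaleR[of B "-1" x] by simp
  have "b \<bullet> x = b' \<bullet> x" for x
    using q[of x] q[of "- x"] c unfolding neg inner_minus_right by linarith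
  then show b: "b = b'" by (metis vector_eq_rdot)
  have d: "x \<bullet> (A *v x) = x \<bullet> (A' *v x)" for x
    using q[of x] b c by simp
  have sym: "x \<bullet> (B *v y) = y \<bullet> (B *v x)" if "symmetric_mat B" for x y and B :: "real ^ 'd ^ 'd"
    using that by (metis symmetric_mat_def dot_lmul_matrix inner_commute transpose_matrix_vector)
  have pol: "2 * (x \<bullet> (B *v y)) = (x + y) \<bullet> (B *v (x + y)) - x \<bullet> (B *v x) - y \<bullet> (B *v y)"
    if "symmetric_mat B" for x y and B :: "real ^ 'd ^ 'd"
    using sym[OF that, of x y] by (simp add: matrix_vector_right_distrib inner_add_left inner_add_right)
  have "x \<bullet> (A *v y) = x \<bullet> (A' *v y)" for x y
    using pol[OF assms(1), of x y] pol[OF assms(2), of x y] d by simp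
  then have "A *v y = A' *v y" for y by (metis vector_eq_ldot)
  then show "A = A'" by (simp add: matrix_eq)
qed

lemma M_quad: "symmetric_mat A \<Longrightarrow> M (quad A b c) = block_mat c b A"
  unfolding M_def by (rule the_equality) (use quad_inject in blast)+

text \<open>Functions in $\mathcal{F}(P,\overline{\mathbb{R}})$ are total functions
  \<open>w\<close> of which only the values on \<open>P\<close> are used; likewise for
  $\lambda \in \mathcal{F}(P,\mathbb{R}_+)$ (written \<open>l\<close>).
  The type \<^typ>\<open>ereal\<close> has $0\cdot(\pm\infty)=0$, $\inf\emptyset=+\infty$ and
  $\sup\emptyset=-\infty$. It also puts $\infty+(-\infty)=\infty$, but this has no influence on the
  relaxed values: such a sum needs some $w(q)=-\infty$, and then the infimum is $-\infty$ anyway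
  (take $\lambda(q)=1$ and all other multipliers $0$).\<close>

definition Asg_abs ::
  "(real ^ 'd \<Rightarrow> real) set \<Rightarrow> (real ^ 'd \<Rightarrow> real ^ 'd) \<Rightarrow>
   ((real ^ 'd \<Rightarrow> real) \<Rightarrow> ereal) \<Rightarrow> (real ^ 'd \<Rightarrow> real) \<Rightarrow> ereal" where
  "Asg_abs P T w p = (SUP x\<in>{x. \<forall>q\<in>P. ereal (q x) \<le> w q}. ereal (p (T x)))"

definition Tst_abs ::
  "(real ^ 'd \<Rightarrow> real) set \<Rightarrow> (real ^ 'd \<Rightarrow> real ^ 'd) \<Rightarrow> (real ^ 'd \<Rightarrow> real) \<Rightarrow>
   ((real ^ 'd \<Rightarrow> real) \<Rightarrow> ereal) \<Rightarrow> (real ^ 'd \<Rightarrow> real) \<Rightarrow> ereal" where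
  "Tst_abs P T r w p = (SUP x\<in>{x. (\<forall>q\<in>P. ereal (q x) \<le> w q) \<and> r x \<le> 0}. ereal (p (T x)))"

definition Asg_rel ::
  "(real ^ 'd \<Rightarrow> real) set \<Rightarrow> (real ^ 'd \<Rightarrow> real ^ 'd) \<Rightarrow>
   ((real ^ 'd \<Rightarrow> real) \<Rightarrow> ereal) \<Rightarrow> (real ^ 'd \<Rightarrow> real) \<Rightarrow> ereal" where
  "Asg_rel P T w p =
     (INF l\<in>P \<rightarrow> {0..}. SUP x.
        ereal (p (T x)) + (\<Sum>q\<in>P. ereal (l q) * (w q - ereal (q x))))"

definition Tst_rel ::
  "(real ^ 'd \<Rightarrow> real) set \<Rightarrow> (real ^ 'd \<Rightarrow> real ^ 'd) \<Rightarrow> (real ^ 'd \<Rightarrow> real) \<Rightarrow>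
   ((real ^ 'd \<Rightarrow> real) \<Rightarrow> ereal) \<Rightarrow> (real ^ 'd \<Rightarrow> real) \<Rightarrow> ereal" where
  "Tst_rel P T r w p =
     (INF (l, \<mu>)\<in>(P \<rightarrow> {0..}) \<times> {0..}. SUP x.
        ereal (p (T x)) + (\<Sum>q\<in>P. ereal (l q) * (w q - ereal (q x))) - ereal (\<mu> * r x))"

end

theory Submission
  imports Defs
begin

text \<open>For real-valued \<open>w\<close> and fixed multipliers, the bracket is a quadratic
  function of x, so a real \<eta> bounds its supremum iff the bracket minus \<eta> is nowhere
  positive. A quadratic function is nowhere positive iff its matrix is negative semi-definite
  (\<open>M_loewner_le_0_iff\<close>), because the quadratic form of that matrix is the
  homogenisation of the function. As \<open>M\<close> is linear on quadratic functions and sends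
  constants to \<open>N\<close>, this condition is the displayed matrix inequality
  (\<open>M_lagrangian\<close>). The infimum of the suprema is the infimum of all their real upper
  bounds (\<open>INF_SUP_quadratic\<close>), which gives (i). Part (ii) is weak duality: at a
  feasible x every multiplier term is nonnegative, so the bracket is at least p(T(x)), whatever the
  multipliers.\<close>

lemma quadraticI: "symmetric_mat A \<Longrightarrow> quadratic (quad A b c)"
  unfolding quadratic_def by blast

lemma quadraticE:
  assumes "quadratic g"
  obtains A b c where "symmetric_mat A" "g = quad A b c"
  using assms unfolding quadratic_def by blast

lemma symmetric_mat_nth: "symmetric_mat A \<longleftrightarrow> (\<forall>i j. A $ i $ j = A $ j $ i)"
  by (auto simp: symmetric_mat_def transpose_def vec_eq_iff)

lemma quadratic_template_imp_quadratic:
  assumes "quadratic_template p"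
  shows "quadratic p"
proof -
  obtain A b where A: "symmetric_mat A" and p: "p = (\<lambda>x. x \<bullet> (A *v x) + b \<bullet> x)"
    using assms unfolding quadratic_template_def by blast
  have "p = quad A b 0"
    by (simp add: p quad_def fun_eq_iff)
  with A show ?thesis
    by (simp add: quadraticI)
qed

section \<open>Linearity of \<open>M\<close> on quadratic functions\<close>

lemma quad_add: "quad A b c x + quad A' b' c' x = quad (A + A') (b + b') (c + c') x"
  by (simp add: quad_def matrix_vector_mult_add_rdistrib inner_add_left inner_add_right)

lemma quad_cmult: "a * quad A b c x = quad (a *\<^sub>R A) (a *\<^sub>R b) (a * c) x"
  by (simp add: quad_def scaleR_matrix_vector_assoc[symmetric] distrib_left)

lemma block_mat_add:
  "block_mat (c + c') (b + b') (A + A') = block_mat c b A + block_mat c' b' A'"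
  by (auto simp: block_mat_def vec_eq_iff algebra_simps split: option.split)

lemma block_mat_cmult: "block_mat (a * c) (a *\<^sub>R b) (a *\<^sub>R A) = a *\<^sub>R block_mat c b A"
  by (auto simp: block_mat_def vec_eq_iff split: option.split)

text \<open>\<open>M\<close> is a definite description, so its value is known only once a
  representation with a symmetric matrix is exhibited. Additivity therefore comes together with
  closure: adding coefficients keeps the matrix symmetric, and \<open>M_quad\<close> evaluates
  \<open>M\<close>.\<close>

lemma
  assumes "quadratic f" "quadratic g"
  shows quadratic_add: "quadratic (\<lambda>x. f x + g x)"
    and M_add: "M (\<lambda>x. f x + g x) = M f + M g"
proof -
  obtain A b c where f: "symmetric_mat A" "f = quad A b c"
    using assms(1) by (rule quadraticE)
  obtain A' b' c' where g: "symmetric_mat A'" "g = quad A' b' c'"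
    using assms(2) by (rule quadraticE)
  have S: "symmetric_mat (A + A')"
    using f g by (simp add: symmetric_mat_nth)
  have eq: "(\<lambda>x. f x + g x) = quad (A + A') (b + b') (c + c')"
    by (simp add: f g quad_add fun_eq_iff)
  show "quadratic (\<lambda>x. f x + g x)"
    unfolding eq by (rule quadraticI[OF S])
  show "M (\<lambda>x. f x + g x) = M f + M g"
    unfolding eq using f g S by (simp add: M_quad block_mat_add)
qed

lemma
  assumes "quadratic f"
  shows quadratic_cmult: "quadratic (\<lambda>x. a * f x)"
    and M_cmult: "M (\<lambda>x. a * f x) = a *\<^sub>R M f"
proof -
  obtain A b c where f: "symmetric_mat A" "f = quad A b c"
    using assms by (rule quadraticE)
  have S: "symmetric_mat (a *\<^sub>R A)"
    using f by (simp add: symmetric_mat_nth)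
  have eq: "(\<lambda>x. a * f x) = quad (a *\<^sub>R A) (a *\<^sub>R b) (a * c)"
    by (simp add: f quad_cmult fun_eq_iff)
  show "quadratic (\<lambda>x. a * f x)"
    unfolding eq by (rule quadraticI[OF S])
  show "M (\<lambda>x. a * f x) = a *\<^sub>R M f"
    unfolding eq using f S by (simp add: M_quad block_mat_cmult)
qed

lemma
  assumes "quadratic f" "quadratic g"
  shows quadratic_diff: "quadratic (\<lambda>x. f x - g x)"
    and M_diff: "M (\<lambda>x. f x - g x) = M f - M g"
  using quadratic_add[OF assms(1) quadratic_cmult[OF assms(2), of "-1"]]
    M_add[OF assms(1) quadratic_cmult[OF assms(2), of "-1"]]
    M_cmult[OF assms(2), of "-1"]
  by simp_all

text \<open>This is what makes \<open>N (w q)\<close> and \<eta> \<open>N (-1)\<close> matrices of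
  quadratic functions, namely of the constants \<open>w q\<close> and -\<eta>.\<close>

lemma
  shows quadratic_const: "quadratic (\<lambda>x :: real ^ 'd. c)"
    and M_const: "M (\<lambda>x :: real ^ 'd. c) = N c"
proof -
  have S: "symmetric_mat (0 :: real ^ 'd ^ 'd)"
    by (simp add: symmetric_mat_nth)
  have eq: "(\<lambda>x :: real ^ 'd. c) = quad 0 0 c"
    by (simp add: quad_def fun_eq_iff)
  show "quadratic (\<lambda>x :: real ^ 'd. c)"
    unfolding eq by (rule quadraticI[OF S])
  show "M (\<lambda>x :: real ^ 'd. c) = N c"
    unfolding eq M_quad[OF S]
    by (auto simp: block_mat_def N_def vec_eq_iff split: option.split)
qed

lemma N_cmult: "a *\<^sub>R N y = N (a * y)"
  by (simp add: N_def vec_eq_iff)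

lemma
  assumes "finite I" "\<And>i. i \<in> I \<Longrightarrow> quadratic (f i)"
  shows quadratic_sum: "quadratic (\<lambda>x :: real ^ 'd. \<Sum>i\<in>I. f i x)"
    and M_sum: "M (\<lambda>x :: real ^ 'd. \<Sum>i\<in>I. f i x) = (\<Sum>i\<in>I. M (f i))"
proof -
  have N0: "N 0 = (0 :: real ^ 'd option ^ 'd option)"
    by (simp add: N_def vec_eq_iff)
  have "quadratic (\<lambda>x. \<Sum>i\<in>I. f i x) \<and> M (\<lambda>x. \<Sum>i\<in>I. f i x) = (\<Sum>i\<in>I. M (f i))"
    using assms
    by (induction I rule: finite_induct)
      (simp_all add: quadratic_const M_const N0 quadratic_add M_add)
  then show "quadratic (\<lambda>x. \<Sum>i\<in>I. f i x)"
    and "M (\<lambda>x. \<Sum>i\<in>I. f i x) = (\<Sum>i\<in>I. M (f i))"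
    by auto
qed

section \<open>Composition with an affine map\<close>

text \<open>Substituting Bx + v turns A into the congruent matrix B^T A B, which is again symmetric.
  Hence \<open>M (p \<circ> T)\<close> falls under the linearity rules.\<close>

lemma quadratic_comp_affine:
  fixes T :: "real ^ 'd \<Rightarrow> real ^ 'd"
  assumes "quadratic p" "affine_map T"
  shows "quadratic (p \<circ> T)"
proof -
  obtain A b c where A: "symmetric_mat A" and p: "p = quad A b c"
    using assms(1) by (rule quadraticE)
  obtain L v where L: "linear L" and T: "T = (\<lambda>x. L x + v)"
    using assms(2) unfolding affine_map_def by blast
  define B where "B = matrix L"
  have LB: "L x = B *v x" for x
    unfolding B_def using L by (simp add: matrix_works)
  have tr: "(B *v x) \<bullet> y = x \<bullet> (transpose B *v y)" for x y
    by (metis dot_lmul_matrix inner_commute transpose_matrix_vector transpose_transpose)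
  have trA: "x \<bullet> (A *v y) = y \<bullet> (A *v x)" for x y
    using A by (metis symmetric_mat_def dot_lmul_matrix inner_commute transpose_matrix_vector)
  have S: "symmetric_mat (transpose B ** (A ** B))"
    using A by (simp add: symmetric_mat_def matrix_transpose_mul matrix_mul_assoc)
  \<comment> \<open>The coefficients come from expanding p(Bx + v): the linear part collects both
    cross terms, equal by symmetry of \<open>A\<close>, and the constant is p(v).\<close>
  have "(p \<circ> T) x = quad (transpose B ** (A ** B))
      (transpose B *v (2 *\<^sub>R (A *v v) + b)) (v \<bullet> (A *v v) + b \<bullet> v + c) x" for x
  proof -
    have "x \<bullet> ((transpose B ** (A ** B)) *v x) = (B *v x) \<bullet> (A *v (B *v x))"
      by (simp add: tr matrix_vector_mul_assoc)
    moreover have "(transpose B *v (2 *\<^sub>R (A *v v) + b)) \<bullet> x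
        = 2 * ((B *v x) \<bullet> (A *v v)) + b \<bullet> (B *v x)"
      by (metis tr inner_commute inner_add_left inner_scaleR_left)
    moreover have "v \<bullet> (A *v (B *v x)) = (B *v x) \<bullet> (A *v v)"
      by (rule trA)
    ultimately show ?thesis
      by (simp add: p T LB quad_def matrix_vector_right_distrib inner_add_left inner_add_right)
  qed
  then have "p \<circ> T = quad (transpose B ** (A ** B))
      (transpose B *v (2 *\<^sub>R (A *v v) + b)) (v \<bullet> (A *v v) + b \<bullet> v + c)"
    by blast
  with quadraticI[OF S] show ?thesis
    by simp
qed

section \<open>Semi-definiteness as a sign condition\<close>

lemma sum_option_UNIV:
  fixes f :: "'d::finite option \<Rightarrow> real"
  shows "sum f UNIV = f None + (\<Sum>i\<in>UNIV. f (Some i))"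
  by (simp add: UNIV_option_conv sum.reindex)

text \<open>Splitting off the coordinate \<open>None\<close> as t, the two off-diagonal halves of b
  add up to t (b \<bullet> x). The result is the homogenisation of
  \<open>quad A b c\<close>.\<close>

lemma inner_block_mat:
  fixes z :: "real ^ 'd::finite option"
  shows "z \<bullet> (block_mat c b A *v z) =
    (let t = z $ None; x = (\<chi> i. z $ Some i) in x \<bullet> (A *v x) + t * (b \<bullet> x) + t\<^sup>2 * c)"
proof -
  have 1: "(\<Sum>i\<in>UNIV. z $ Some i * (b $ i * z $ None) / 2) =
      z $ None * (\<Sum>i\<in>UNIV. b $ i * z $ Some i) / 2"
    by (simp add: sum_distrib_left sum_divide_distrib mult_ac)
  have 2: "(\<Sum>i\<in>UNIV. b $ i * z $ Some i / 2) = (\<Sum>i\<in>UNIV. b $ i * z $ Some i) / 2"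
    by (simp only: sum_divide_distrib)
  show ?thesis
    by (simp add: Let_def inner_vec_def matrix_vector_mult_def block_mat_def sum_option_UNIV
        distrib_left sum.distrib power2_eq_square 1 2)
qed

text \<open>The form of \<open>M g\<close> at \<open>(t, x)\<close> is \<open>t\<^sup>2 * g (x / t)\<close> for \<open>t \<noteq> 0\<close>;
  continuity in \<open>t\<close> covers the recession directions \<open>t = 0\<close>.\<close>

lemma M_loewner_le_0_iff:
  assumes "quadratic (g :: real ^ 'd \<Rightarrow> real)"
  shows "M g \<preceq> 0 \<longleftrightarrow> (\<forall>x. g x \<le> 0)"
proof -
  obtain A b c where A: "symmetric_mat A" and g: "g = quad A b c"
    using assms by (rule quadraticE)
  have "symmetric_mat (0 - block_mat c b A)"
    using A by (auto simp: symmetric_mat_nth block_mat_def split: option.split)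
  moreover have "z \<bullet> ((0 - block_mat c b A) *v z) = - (z \<bullet> (block_mat c b A *v z))" for z
    by (metis diff_0 inner_diff_right inner_zero_right matrix_vector_mult_0
        matrix_vector_mult_diff_rdistrib)
  ultimately have psd: "M g \<preceq> 0 \<longleftrightarrow> (\<forall>z. z \<bullet> (block_mat c b A *v z) \<le> 0)"
    by (simp add: g M_quad[OF A] loewner_le_def pos_semidef_def)
  show ?thesis
  proof
    assume "M g \<preceq> 0"
    then have *: "z \<bullet> (block_mat c b A *v z) \<le> 0" for z
      by (simp add: psd)
    show "\<forall>x. g x \<le> 0"
    proof
      fix x
      show "g x \<le> 0"
        \<comment> \<open>At the vector (1, x) the homogenised form is g(x) itself.\<close>
        using *[of "\<chi> i. case i of None \<Rightarrow> 1 | Some k \<Rightarrow> x $ k"]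
        by (simp add: inner_block_mat Let_def g quad_def)
    qed
  next
    assume neg: "\<forall>x. g x \<le> 0"
    have "x \<bullet> (A *v x) + t * (b \<bullet> x) + t\<^sup>2 * c \<le> 0" for t x
    proof -
      let ?h = "\<lambda>t. x \<bullet> (A *v x) + t * (b \<bullet> x) + t\<^sup>2 * c"
      have pos: "?h s \<le> 0" if "s \<noteq> 0" for s
      proof -
        have "?h s = s\<^sup>2 * g ((1 / s) *\<^sub>R x)"
          using that
          by (simp add: g quad_def matrix_vector_mult_scaleR field_simps power2_eq_square)
        then show ?thesis
          using neg by (simp add: mult_nonneg_nonpos)
      qed
      have "(?h \<longlongrightarrow> ?h t) (at t)"
        by (intro tendsto_intros)
      moreover have "\<forall>\<^sub>F s in at t. s \<noteq> 0"
        by (rule eventually_neq_at_within)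
      then have "\<forall>\<^sub>F s in at t. ?h s \<le> 0"
        by eventually_elim (rule pos)
      ultimately show ?thesis
        by (rule tendsto_upperbound) simp
    qed
    then show "M g \<preceq> 0"
      by (simp add: psd inner_block_mat Let_def)
  qed
qed

section \<open>From infima of suprema to matrix inequalities\<close>

text \<open>A finite supremum is itself one of the admissible \<eta>, and an infinite one bounds any
  infimum from above. This replaces an extended-real supremum by a condition on real
  numbers.\<close>

lemma INF_SUP_ereal_eq:
  fixes F :: "'a \<Rightarrow> 'b \<Rightarrow> real"
  shows "(INF l\<in>L. SUP x. ereal (F l x)) = Inf {ereal \<eta> | \<eta> l. l \<in> L \<and> (\<forall>x. F l x \<le> \<eta>)}"
    (is "_ = Inf ?S")
proof (rule antisym)
  show "(INF l\<in>L. SUP x. ereal (F l x)) \<le> Inf ?S"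
  proof (rule Inf_greatest)
    fix y assume "y \<in> ?S"
    then obtain \<eta> l where "y = ereal \<eta>" "l \<in> L" "\<forall>x. F l x \<le> \<eta>"
      by blast
    then show "(INF l\<in>L. SUP x. ereal (F l x)) \<le> y"
      by (intro INF_lower2[of l] SUP_least) auto
  qed
  show "Inf ?S \<le> (INF l\<in>L. SUP x. ereal (F l x))"
  proof (rule INF_greatest)
    fix l assume l: "l \<in> L"
    let ?s = "SUP x. ereal (F l x)"
    have le: "ereal (F l x) \<le> ?s" for x
      by (rule SUP_upper) simp
    show "Inf ?S \<le> ?s"
    proof (cases ?s)
      case (real \<eta>)
      have "F l x \<le> \<eta>" for x
        using le[of x] by (simp add: real)
      with l show ?thesis
        unfolding real by (auto intro!: Inf_lower)
    next
      case MInf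
      then show ?thesis
        \<comment> \<open>The supremum ranges over a nonempty type and all values are real, so it
          cannot be -\<infinity>.\<close>
        using le[of undefined] by simp
    qed simp
  qed
qed

text \<open>The index \<open>l\<close> is abstract so that the same lemma serves multipliers
  \<lambda> alone and pairs (\<lambda>, \<mu>). Adding \<eta> \<open>N (-1)\<close> amounts to
  subtracting the constant \<eta> from the function.\<close>

lemma INF_SUP_quadratic:
  fixes F :: "'a \<Rightarrow> real ^ 'd \<Rightarrow> real"
  assumes "\<And>l. l \<in> L \<Longrightarrow> quadratic (F l)"
  shows "(INF l\<in>L. SUP x. ereal (F l x)) =
    Inf {ereal \<eta> | \<eta> l. l \<in> L \<and> M (F l) + \<eta> *\<^sub>R N (-1) \<preceq> 0}"
proof -
  have "M (F l) + \<eta> *\<^sub>R N (-1) \<preceq> 0 \<longleftrightarrow> (\<forall>x. F l x \<le> \<eta>)" if "l \<in> L" for l \<eta>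
  proof -
    have "M (F l) + \<eta> *\<^sub>R N (-1) = M (\<lambda>x. F l x + - \<eta>)"
      by (simp only: M_add[OF assms[OF that] quadratic_const] M_const N_cmult mult_minus_right mult_1_right)
    then show ?thesis
      using M_loewner_le_0_iff[OF quadratic_add[OF assms[OF that] quadratic_const[of "- \<eta>"]]]
      by simp
  qed
  then have "{ereal \<eta> | \<eta> l. l \<in> L \<and> M (F l) + \<eta> *\<^sub>R N (-1) \<preceq> 0} =
      {ereal \<eta> | \<eta> l. l \<in> L \<and> (\<forall>x. F l x \<le> \<eta>)}"
    by blast
  then show ?thesis
    by (simp only: INF_SUP_ereal_eq)
qed

section \<open>The semi-definite programs\<close>

lemma
  fixes P :: "(real ^ 'd \<Rightarrow> real) set"
  assumes "finite P" "\<And>q. q \<in> P \<Longrightarrow> quadratic q" "quadratic f"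
  shows quadratic_lagrangian: "quadratic (\<lambda>x. f x + (\<Sum>q\<in>P. l q * (w q - q x)))"
    and M_lagrangian: "M (\<lambda>x. f x + (\<Sum>q\<in>P. l q * (w q - q x))) =
      M f + (\<Sum>q\<in>P. l q *\<^sub>R (N (w q) - M q))"
proof -
  have Q: "quadratic (\<lambda>x. l q * (w q - q x))" if "q \<in> P" for q
    using assms(2)[OF that] by (intro quadratic_cmult quadratic_diff quadratic_const)
  have MQ: "M (\<lambda>x. l q * (w q - q x)) = l q *\<^sub>R (N (w q) - M q)" if "q \<in> P" for q
    using assms(2)[OF that] by (simp add: M_cmult M_diff M_const quadratic_diff quadratic_const)
  show "quadratic (\<lambda>x. f x + (\<Sum>q\<in>P. l q * (w q - q x)))"
    using assms Q by (intro quadratic_add quadratic_sum)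
  show "M (\<lambda>x. f x + (\<Sum>q\<in>P. l q * (w q - q x))) = M f + (\<Sum>q\<in>P. l q *\<^sub>R (N (w q) - M q))"
    using assms Q by (simp add: M_add M_sum quadratic_sum MQ)
qed

lemma Asg_rel_eq_sdp:
  assumes "finite P" "\<And>q. q \<in> P \<Longrightarrow> quadratic q" "quadratic (p \<circ> T)"
  shows "Asg_rel P T (\<lambda>q. ereal (w q)) p =
    Inf {ereal \<eta> | \<eta> l. l \<in> P \<rightarrow> {0..} \<and>
      M (p \<circ> T) + \<eta> *\<^sub>R N (-1) + (\<Sum>q\<in>P. l q *\<^sub>R (N (w q) - M q)) \<preceq> 0}"
proof -
  let ?F = "\<lambda>l x. (p \<circ> T) x + (\<Sum>q\<in>P. l q * (w q - q x))"
  have MF: "M (?F l) = M (p \<circ> T) + (\<Sum>q\<in>P. l q *\<^sub>R (N (w q) - M q))" for l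
    using assms by (rule M_lagrangian)
  \<comment> \<open>With \<open>w\<close> real no infinity occurs, and the extended-real bracket
    collapses to a real expression.\<close>
  have "Asg_rel P T (\<lambda>q. ereal (w q)) p = (INF l\<in>P \<rightarrow> {0..}. SUP x. ereal (?F l x))"
    by (simp add: Asg_rel_def)
  also have "\<dots> = Inf {ereal \<eta> | \<eta> l. l \<in> P \<rightarrow> {0..} \<and> M (?F l) + \<eta> *\<^sub>R N (-1) \<preceq> 0}"
    by (rule INF_SUP_quadratic) (rule quadratic_lagrangian[OF assms])
  also have "{ereal \<eta> | \<eta> l. l \<in> P \<rightarrow> {0..} \<and> M (?F l) + \<eta> *\<^sub>R N (-1) \<preceq> 0} =
      {ereal \<eta> | \<eta> l. l \<in> P \<rightarrow> {0..} \<and>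
        M (p \<circ> T) + \<eta> *\<^sub>R N (-1) + (\<Sum>q\<in>P. l q *\<^sub>R (N (w q) - M q)) \<preceq> 0}"
    unfolding MF by (simp add: algebra_simps)
  finally show ?thesis .
qed

lemma Tst_rel_eq_sdp:
  assumes "finite P" "\<And>q. q \<in> P \<Longrightarrow> quadratic q" "quadratic (p \<circ> T)" "quadratic r"
  shows "Tst_rel P T r (\<lambda>q. ereal (w q)) p =
    Inf {ereal \<eta> | \<eta> l \<mu>. l \<in> P \<rightarrow> {0..} \<and> \<mu> \<in> {0..} \<and>
      M (p \<circ> T) + \<eta> *\<^sub>R N (-1) + (\<Sum>q\<in>P. l q *\<^sub>R (N (w q) - M q)) - \<mu> *\<^sub>R M r \<preceq> 0}"
proof -
  let ?G = "\<lambda>l x. (p \<circ> T) x + (\<Sum>q\<in>P. l q * (w q - q x))"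
  \<comment> \<open>Both multipliers are packed into one pair \<open>k\<close>, the single index
    expected by \<open>INF_SUP_quadratic\<close>.\<close>
  let ?F = "\<lambda>k x. ?G (fst k) x - snd k * r x"
  let ?L = "(P \<rightarrow> {0..}) \<times> {0..}"
  have Q: "quadratic (?F k)" for k
    using assms by (intro quadratic_diff quadratic_cmult quadratic_lagrangian)
  have MF: "M (?F k) = M (p \<circ> T) + (\<Sum>q\<in>P. fst k q *\<^sub>R (N (w q) - M q)) - snd k *\<^sub>R M r" for k
    using M_diff[OF quadratic_lagrangian[OF assms(1-3)] quadratic_cmult[OF assms(4)]]
      M_lagrangian[OF assms(1-3)] M_cmult[OF assms(4)]
    by simp
  have "Tst_rel P T r (\<lambda>q. ereal (w q)) p = (INF k\<in>?L. SUP x. ereal (?F k x))"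
    by (simp add: Tst_rel_def case_prod_beta)
  also have "\<dots> = Inf {ereal \<eta> | \<eta> k. k \<in> ?L \<and> M (?F k) + \<eta> *\<^sub>R N (-1) \<preceq> 0}"
    by (rule INF_SUP_quadratic) (rule Q)
  also have "{ereal \<eta> | \<eta> k. k \<in> ?L \<and> M (?F k) + \<eta> *\<^sub>R N (-1) \<preceq> 0} =
      {ereal \<eta> | \<eta> l \<mu>. l \<in> P \<rightarrow> {0..} \<and> \<mu> \<in> {0..} \<and>
        M (p \<circ> T) + \<eta> *\<^sub>R N (-1) + (\<Sum>q\<in>P. l q *\<^sub>R (N (w q) - M q)) - \<mu> *\<^sub>R M r \<preceq> 0}"
    unfolding MF by (simp add: algebra_simps)
  finally show ?thesis .
qed

section \<open>Weak duality\<close>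

text \<open>Feasibility of \<open>x\<close> excludes \<open>w q\<close> = -\<infinity> and makes
  each difference nonnegative, possibly +\<infinity>. Products of nonnegative extended reals stay
  nonnegative, also for 0 times \<infinity>.\<close>

lemma sum_multipliers_nonneg:
  assumes "l \<in> P \<rightarrow> {0..}" "\<forall>q\<in>P. ereal (q x) \<le> w q"
  shows "0 \<le> (\<Sum>q\<in>P. ereal (l q) * (w q - ereal (q x)))"
  using assms by (intro sum_nonneg ereal_0_le_mult) (auto simp: ereal_diff_positive)

text \<open>For every feasible x and every \<lambda>, the bracket at that same x already dominates
  p(T(x)); the supremum over all points is only larger.\<close>

lemma Asg_abs_le_Asg_rel: "Asg_abs P T w p \<le> Asg_rel P T w p"
  unfolding Asg_abs_def Asg_rel_def
proof (intro SUP_least INF_greatest)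
  fix x l assume x: "x \<in> {x. \<forall>q\<in>P. ereal (q x) \<le> w q}" and l: "l \<in> P \<rightarrow> {0::real..}"
  have "ereal (p (T x)) \<le> ereal (p (T x)) + (\<Sum>q\<in>P. ereal (l q) * (w q - ereal (q x)))"
    using sum_multipliers_nonneg[OF l, of x w] x by (simp add: ereal_le_add_self)
  also have "\<dots> \<le> (SUP x. ereal (p (T x)) + (\<Sum>q\<in>P. ereal (l q) * (w q - ereal (q x))))"
    by (rule SUP_upper) simp
  finally show "ereal (p (T x)) \<le> \<dots>" .
qed

lemma Tst_abs_le_Tst_rel: "Tst_abs P T r w p \<le> Tst_rel P T r w p"
  unfolding Tst_abs_def Tst_rel_def case_prod_beta
proof (intro SUP_least INF_greatest)
  fix x k
  assume x: "x \<in> {x. (\<forall>q\<in>P. ereal (q x) \<le> w q) \<and> r x \<le> 0}"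
    and k: "k \<in> (P \<rightarrow> {0::real..}) \<times> {0::real..}"
  let ?S = "\<lambda>x. \<Sum>q\<in>P. ereal (fst k q) * (w q - ereal (q x))"
  have "0 \<le> ?S x"
    using x k by (intro sum_multipliers_nonneg) auto
  moreover have "snd k * r x \<le> 0"
    using x k by (auto intro: mult_nonneg_nonpos)
  ultimately have "ereal (p (T x)) \<le> ereal (p (T x)) + ?S x - ereal (snd k * r x)"
    \<comment> \<open>The sum may be +\<infinity>, so extended subtraction is resolved by cases;
      -\<infinity> contradicts nonnegativity.\<close>
    by (cases "?S x") auto
  also have "\<dots> \<le> (SUP x. ereal (p (T x)) + ?S x - ereal (snd k * r x))"
    by (rule SUP_upper) simp
  finally show "ereal (p (T x)) \<le> \<dots>" .
qed

theorem theorem3p13: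
  fixes P :: "(real ^ 'd \<Rightarrow> real) set"
    and T :: "real ^ 'd \<Rightarrow> real ^ 'd"
    and r :: "real ^ 'd \<Rightarrow> real"
  assumes "finite P"
    and "\<forall>p\<in>P. quadratic_template p"
    and "affine_map T"
    and "quadratic r"
  shows "(\<forall>w :: (real ^ 'd \<Rightarrow> real) \<Rightarrow> real. \<forall>p\<in>P.
            Asg_rel P T (\<lambda>q. ereal (w q)) p =
              Inf {ereal \<eta> | \<eta> l. l \<in> P \<rightarrow> {0..} \<and>
                M (p \<circ> T) + \<eta> *\<^sub>R N (-1) + (\<Sum>q\<in>P. l q *\<^sub>R (N (w q) - M q)) \<preceq> 0} \<and>
            Tst_rel P T r (\<lambda>q. ereal (w q)) p =
              Inf {ereal \<eta> | \<eta> l \<mu>. l \<in> P \<rightarrow> {0..} \<and> \<mu> \<in> {0..} \<and>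
                M (p \<circ> T) + \<eta> *\<^sub>R N (-1) + (\<Sum>q\<in>P. l q *\<^sub>R (N (w q) - M q)) - \<mu> *\<^sub>R M r \<preceq> 0}) \<and>
         (\<forall>w :: (real ^ 'd \<Rightarrow> real) \<Rightarrow> ereal. \<forall>p\<in>P.
            Asg_abs P T w p \<le> Asg_rel P T w p \<and>
            Tst_abs P T r w p \<le> Tst_rel P T r w p)"
proof -
  have q: "quadratic q" if "q \<in> P" for q
    using assms(2) that quadratic_template_imp_quadratic by blast
  have "quadratic (p \<circ> T)" if "p \<in> P" for p
    using q[OF that] assms(3) by (rule quadratic_comp_affine)
  then show ?thesis
    using Asg_rel_eq_sdp[OF assms(1) q] Tst_rel_eq_sdp[OF assms(1) q _ assms(4)]
      Asg_abs_le_Asg_rel Tst_abs_le_Tst_rel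
    by blast
qed

end
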